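(* Let $m,n$ be positive integers and let $\mathcal{R}_{n,m}$ be the random linear code ensemble. For integers $w_1,w_2$ with $0<w_1,w_2\le n$, the covariance of the weight distributions $A_{w_1}(\cdot)$ and $A_{w_2}(\cdot)$ over $\mathcal{R}_{n,m}$ is $$\mathrm{COV}_{\mathcal{R}_{n,m}}[A_{w_1},A_{w_2}]=\begin{cases}0, & 0<w_1,w_2\le n,\ w_1\neq w_2,\\ (1-2^{-m})\,2^{-m}\binom{n}{w}, & 0<w_1=w_2=w\le n.\end{cases}$$
   Context: The random linear code ensemble $\mathcal{R}_{n,m}$ is the set of all binary $m\times n$ matrices (over $F_2$), each having equal probability $P(H)=2^{-nm}$. For a real-valued function $f$ on $\mathcal{R}_{n,m}$, $\mathrm{E}_{\mathcal{R}_{n,m}}[f]=\sum_H P(H)f(H)$, and $\mathrm{COV}_{\mathcal{R}_{n,m}}[f,g]=\mathrm{E}_{\mathcal{R}_{n,m}}[fg]-\mathrm{E}_{\mathcal{R}_{n,m}}[f]\,\mathrm{E}_{\mathcal{R}_{n,m}}[g]$. For $w\in\{0,\dots,n\}$, $A_w(H)$ is the number of binary column vectors $x\in F_2^n$ of Hamming weight $w$ with $Hx=0$ over $F_2$. *)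

theory Defs
  imports "HOL-Library.Z2" "Jordan_Normal_Form.Matrix"
begin

text \<open>Dimension parameters are in the order \<open>n m\<close> (code length, then number of parity checks),
  whereas \<^const>\<open>carrier_mat\<close> takes the number of rows first.\<close>

definition code_ensemble :: "nat \<Rightarrow> nat \<Rightarrow> bit mat set" where
  "code_ensemble n m = carrier_mat m n"

definition ensemble_prob :: "nat \<Rightarrow> nat \<Rightarrow> bit mat \<Rightarrow> real" where
  "ensemble_prob n m H = 1 / 2 ^ (n * m)"

definition ensemble_expectation :: "nat \<Rightarrow> nat \<Rightarrow> (bit mat \<Rightarrow> real) \<Rightarrow> real" where
  "ensemble_expectation n m f = (\<Sum>H\<in>code_ensemble n m. ensemble_prob n m H * f H)"

definition ensemble_cov ::
    "nat \<Rightarrow> nat \<Rightarrow> (bit mat \<Rightarrow> real) \<Rightarrow> (bit mat \<Rightarrow> real) \<Rightarrow> real" where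
  "ensemble_cov n m f g =
     ensemble_expectation n m (\<lambda>H. f H * g H)
       - ensemble_expectation n m f * ensemble_expectation n m g"

definition hamming_weight :: "bit vec \<Rightarrow> nat" where
  "hamming_weight x = card {i. i < dim_vec x \<and> x $ i \<noteq> 0}"

definition weight_distribution :: "nat \<Rightarrow> bit mat \<Rightarrow> nat" where
  "weight_distribution w H =
     card {x \<in> carrier_vec (dim_col H).
             hamming_weight x = w \<and> H *\<^sub>v x = 0\<^sub>v (dim_row H)}"

end

theory Submission
  imports Defs
begin

text \<open>Write \<open>A\<^sub>w\<close> as the sum of the indicators of \<open>H x = 0\<close> over the words \<open>x\<close> of weight \<open>w\<close>; the
  covariance is then the double sum of the covariances of these indicators. The rows of \<open>H\<close> are
  independent and uniform, so each such covariance is computed from a single row. For nonzero \<open>x\<close>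
  a row is orthogonal to \<open>x\<close> with probability \<open>1/2\<close>, and for distinct nonzero \<open>x\<close>, \<open>y\<close> the two
  orthogonality events are independent, because \<open>x\<close> and \<open>y\<close> differ in some coordinate and flipping
  that coordinate of the row toggles exactly one of the two inner products. Hence only the diagonal
  terms \<open>x = y\<close> survive.\<close>

text \<open>A nonzero entry of type \<open>bit\<close> is 1, so a word is determined by its support.
  Counting words, also of a given weight, thus becomes counting subsets of
  \<open>{..<n}\<close>.\<close>

lemma bij_betw_vec_support:
  "bij_betw (\<lambda>x::bit vec. {i. i < dim_vec x \<and> x $ i \<noteq> 0}) (carrier_vec n) (Pow {..<n})"
proof (rule bij_betw_byWitness[where f' = "\<lambda>A. vec n (\<lambda>i. of_bool (i \<in> A))"])
  show "\<forall>x\<in>carrier_vec n :: bit vec set. vec n (\<lambda>i. of_bool (i \<in> {i. i < dim_vec x \<and> x $ i \<noteq> 0})) = x"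
    by (auto simp: vec_eq_iff)
qed (auto split: if_splits)

lemma finite_carrier_bit_vec: "finite (carrier_vec n :: bit vec set)"
  using bij_betw_finite[OF bij_betw_vec_support[of n]] by simp

lemma card_carrier_bit_vec: "card (carrier_vec n :: bit vec set) = 2 ^ n"
  using bij_betw_same_card[OF bij_betw_vec_support[of n]] by (simp add: card_Pow)

lemma card_hamming_weight_eq:
  "card {x \<in> carrier_vec n. hamming_weight x = w} = n choose w"
proof -
  let ?supp = "\<lambda>x::bit vec. {i. i < dim_vec x \<and> x $ i \<noteq> 0}"
  have "bij_betw ?supp {x \<in> carrier_vec n. hamming_weight x = w} {A \<in> Pow {..<n}. card A = w}"
    by (rule bij_betw_Collect[OF bij_betw_vec_support]) (simp add: hamming_weight_def)
  then show ?thesis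
    using n_subsets[of "{..<n}" w] by (simp add: bij_betw_same_card Pow_def)
qed

lemma hamming_weight_zero_vec: "hamming_weight (0\<^sub>v n) = 0"
  by (simp add: hamming_weight_def)

text \<open>A condition imposed on each row separately turns the set of matrices into an
  \<open>m\<close>-fold product. This is the source of the independence of the rows.\<close>

lemma bij_betw_rows:
  assumes "S \<subseteq> carrier_vec n"
  shows "bij_betw (\<lambda>H. \<lambda>i\<in>{..<m}. row H i)
    {H \<in> carrier_mat m n. \<forall>i<m. row H i \<in> S} ({..<m} \<rightarrow>\<^sub>E S)"
proof (rule bij_betw_byWitness[where f' = "\<lambda>f. mat_of_rows n (map f [0..<m])"])
  show "\<forall>H\<in>{H \<in> carrier_mat m n. \<forall>i<m. row H i \<in> S}.
      mat_of_rows n (map (\<lambda>i\<in>{..<m}. row H i) [0..<m]) = H"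
    by (auto intro!: eq_matI simp: mat_of_rows_def)
  have row: "row (mat_of_rows n (map f [0..<m])) i = f i" if "f \<in> {..<m} \<rightarrow>\<^sub>E S" "i < m" for f i
    using that assms by (subst mat_of_rows_row) auto
  then show "\<forall>f\<in>{..<m} \<rightarrow>\<^sub>E S. (\<lambda>i\<in>{..<m}. row (mat_of_rows n (map f [0..<m])) i) = f"
    by (fastforce simp: fun_eq_iff PiE_def extensional_def)
  show "(\<lambda>H. \<lambda>i\<in>{..<m}. row H i) ` {H \<in> carrier_mat m n. \<forall>i<m. row H i \<in> S} \<subseteq> {..<m} \<rightarrow>\<^sub>E S"
    by auto
  show "(\<lambda>f. mat_of_rows n (map f [0..<m])) ` ({..<m} \<rightarrow>\<^sub>E S)
      \<subseteq> {H \<in> carrier_mat m n. \<forall>i<m. row H i \<in> S}"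
    using row by (auto simp: PiE_mem)
qed

lemma card_mat_rows_in:
  assumes "S \<subseteq> carrier_vec n"
  shows "card {H \<in> carrier_mat m n. \<forall>i<m. row H i \<in> S} = card S ^ m"
  using bij_betw_same_card[OF bij_betw_rows[OF assms, of m]] by (simp add: card_PiE)

lemma finite_carrier_bit_mat: "finite (carrier_mat m n :: bit mat set)"
proof -
  have "{H \<in> carrier_mat m n. \<forall>i<m. row H i \<in> carrier_vec n} = (carrier_mat m n :: bit mat set)"
    by auto
  with bij_betw_finite[OF bij_betw_rows[of "carrier_vec n :: bit vec set" n m]] show ?thesis
    by (simp add: finite_PiE finite_carrier_bit_vec)
qed

text \<open>In characteristic 2, translation by \<open>e\<close> is an involution of
  \<open>S\<close>, and as \<open>e \<bullet> x = 1\<close> it swaps the vectors orthogonal to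
  \<open>x\<close> with the others. The set \<open>S\<close> is kept general so that the halving
  also applies inside a hyperplane.\<close>

lemma card_eq_twice_card_orthogonal:
  fixes x e :: "bit vec"
  assumes S: "S \<subseteq> carrier_vec n" and x: "x \<in> carrier_vec n" and e: "e \<in> carrier_vec n"
    and ex: "e \<bullet> x = 1" and closed: "\<And>r. r \<in> S \<Longrightarrow> r + e \<in> S"
  shows "card S = 2 * card {r \<in> S. r \<bullet> x = 0}"
proof -
  have fin: "finite S"
    using S finite_carrier_bit_vec finite_subset by blast
  have dot: "(r + e) \<bullet> x = r \<bullet> x + 1" if "r \<in> S" for r
    using that S x e ex by (subst add_scalar_prod_distrib[of _ n]) auto
  have invol: "r + e + e = r" if "r \<in> S" for r
    using that S e by (auto simp: vec_eq_iff)
  have "bij_betw (\<lambda>r. r + e) {r \<in> S. r \<bullet> x = 0} {r \<in> S. r \<bullet> x \<noteq> 0}"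
    by (rule bij_betw_byWitness[where f' = "\<lambda>r. r + e"]) (auto simp: closed dot invol)
  then have "card {r \<in> S. r \<bullet> x = 0} = card {r \<in> S. r \<bullet> x \<noteq> 0}"
    by (rule bij_betw_same_card)
  moreover have "card S = card {r \<in> S. r \<bullet> x = 0} + card {r \<in> S. r \<bullet> x \<noteq> 0}"
    using fin by (subst card_Un_disjoint[symmetric]) (auto intro: arg_cong[where f = card])
  ultimately show ?thesis
    by simp
qed

lemma card_orthogonal:
  fixes x :: "bit vec"
  assumes x: "x \<in> carrier_vec n" and "x \<noteq> 0\<^sub>v n"
  shows "2 * card {r \<in> carrier_vec n. r \<bullet> x = 0} = 2 ^ n"
proof -
  obtain j where j: "j < n" "x $ j = 1"
    using assms by (auto simp: vec_eq_iff)
  then show ?thesis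
    using card_eq_twice_card_orthogonal[of "carrier_vec n" n x "unit_vec n j"] x
    by (simp add: card_carrier_bit_vec)
qed

lemma card_orthogonal_pair:
  fixes x y :: "bit vec"
  assumes "x \<in> carrier_vec n" "y \<in> carrier_vec n" "x \<noteq> 0\<^sub>v n" "y \<noteq> 0\<^sub>v n" "x \<noteq> y"
  shows "4 * card {r \<in> carrier_vec n. r \<bullet> x = 0 \<and> r \<bullet> y = 0} = 2 ^ n"
proof -
  have separated: "4 * card {r \<in> carrier_vec n. r \<bullet> u = 0 \<and> r \<bullet> v = 0} = 2 ^ n"
    if u: "u \<in> carrier_vec n" and v: "v \<in> carrier_vec n" "v \<noteq> 0\<^sub>v n"
      and j: "j < n" "u $ j = 1" "v $ j = 0" for u v :: "bit vec" and j
  proof -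
    let ?S = "{r \<in> carrier_vec n. r \<bullet> v = 0}"
    \<comment> \<open>Flipping coordinate \<open>j\<close> leaves the product with \<open>v\<close>
      unchanged because \<open>v $ j = 0\<close>; the hyperplane of \<open>v\<close> is then halved
      by \<open>u\<close>.\<close>
    have "r + unit_vec n j \<in> ?S" if "r \<in> ?S" for r
      using that v j by (auto simp: add_scalar_prod_distrib[of _ n])
    then have "card ?S = 2 * card {r \<in> ?S. r \<bullet> u = 0}"
      using u j by (intro card_eq_twice_card_orthogonal[of _ n _ "unit_vec n j"]) auto
    moreover have "{r \<in> ?S. r \<bullet> u = 0} = {r \<in> carrier_vec n. r \<bullet> u = 0 \<and> r \<bullet> v = 0}"
      by auto
    ultimately show ?thesis
      using card_orthogonal[OF v] by simp
  qed
  obtain j where j: "j < n" "x $ j \<noteq> y $ j"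
    using assms by (auto simp: vec_eq_iff)
  show ?thesis
  \<comment> \<open>Exactly one of \<open>x $ j\<close>, \<open>y $ j\<close> is 1; that word takes
    the role of \<open>u\<close>.\<close>
  proof (cases "x $ j = 0")
    case True
    then show ?thesis
      using separated[of y x j] assms j by (simp add: conj_commute)
  next
    case False
    then show ?thesis
      using separated[of x y j] assms j by simp
  qed
qed

lemma mult_mat_vec_eq_zero_iff:
  assumes "H \<in> carrier_mat m n"
  shows "H *\<^sub>v x = 0\<^sub>v m \<longleftrightarrow> (\<forall>i<m. row H i \<bullet> x = 0)"
  using assms by (auto simp: vec_eq_iff)

lemma ensemble_expectation_of_bool:
  "ensemble_expectation n m (\<lambda>H. of_bool (P H))
    = real (card {H \<in> carrier_mat m n. P H}) / 2 ^ (n * m)"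
  by (simp add: ensemble_expectation_def ensemble_prob_def code_ensemble_def
      finite_carrier_bit_mat Int_def flip: sum_divide_distrib)

text \<open>Here \<open>1 / c\<close> is the probability that one uniform row satisfies
  \<open>P\<close>; the \<open>m\<close> rows contribute equal independent factors. It is used with
  \<open>c = 2\<close> and \<open>c = 4\<close>.\<close>

lemma ensemble_expectation_rows:
  fixes P :: "bit vec \<Rightarrow> bool"
  assumes "\<And>H. H \<in> carrier_mat m n \<Longrightarrow> Q H \<longleftrightarrow> (\<forall>i<m. P (row H i))"
    and "c * card {r \<in> carrier_vec n. P r} = 2 ^ n"
  shows "ensemble_expectation n m (\<lambda>H. of_bool (Q H)) = 1 / real c ^ m"
proof -
  have "{H \<in> carrier_mat m n. Q H}
      = {H \<in> carrier_mat m n. \<forall>i<m. row H i \<in> {r \<in> carrier_vec n. P r}}"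
    using assms(1) by auto
  then have "card {H \<in> carrier_mat m n. Q H} = card {r \<in> carrier_vec n. P r} ^ m"
    using card_mat_rows_in[of "{r \<in> carrier_vec n. P r}" n m] by auto
  moreover have "real c * real (card {r \<in> carrier_vec n. P r}) = 2 ^ n"
    using assms(2) by (metis of_nat_mult of_nat_numeral of_nat_power)
  then have "real c ^ m * real (card {r \<in> carrier_vec n. P r}) ^ m = 2 ^ (n * m)"
    by (simp add: power_mult flip: power_mult_distrib)
  moreover have "c \<noteq> 0"
    using assms(2) by (intro notI) simp
  ultimately show ?thesis
    by (simp add: ensemble_expectation_of_bool field_simps)
qed

lemma ensemble_cov_kernel_indicators:
  fixes x y :: "bit vec"
  assumes x: "x \<in> carrier_vec n" "x \<noteq> 0\<^sub>v n" and y: "y \<in> carrier_vec n" "y \<noteq> 0\<^sub>v n"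
  shows "ensemble_cov n m (\<lambda>H. of_bool (H *\<^sub>v x = 0\<^sub>v m)) (\<lambda>H. of_bool (H *\<^sub>v y = 0\<^sub>v m))
    = (if x = y then (1 - 1 / 2 ^ m) * (1 / 2 ^ m) else 0)"
proof -
  have single: "ensemble_expectation n m (\<lambda>H. of_bool (H *\<^sub>v z = 0\<^sub>v m)) = 1 / 2 ^ m"
    if "z \<in> carrier_vec n" "z \<noteq> 0\<^sub>v n" for z :: "bit vec"
    using ensemble_expectation_rows[OF mult_mat_vec_eq_zero_iff card_orthogonal[OF that]] by simp
  show ?thesis
  \<comment> \<open>With \<open>p = 1 / 2 ^ m\<close>, the diagonal case is the Bernoulli variance
    \<open>p - p * p\<close>, since an indicator equals its square. Off the diagonal the joint
    probability \<open>1 / 4 ^ m\<close> equals \<open>p * p\<close>.\<close>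
  proof (cases "x = y")
    case True
    then show ?thesis
      by (simp add: ensemble_cov_def single[OF y] field_simps flip: of_bool_conj)
  next
    case False
    have "ensemble_expectation n m (\<lambda>H. of_bool (H *\<^sub>v x = 0\<^sub>v m \<and> H *\<^sub>v y = 0\<^sub>v m))
        = 1 / real 4 ^ m"
      using card_orthogonal_pair[OF x(1) y(1) x(2) y(2) False]
      by (intro ensemble_expectation_rows[where P = "\<lambda>r. r \<bullet> x = 0 \<and> r \<bullet> y = 0"])
        (auto simp: mult_mat_vec_eq_zero_iff)
    then show ?thesis
      using False
      by (simp add: ensemble_cov_def single[OF x] single[OF y] of_bool_conj
          flip: power_mult_distrib)
  qed
qed

lemma ensemble_expectation_cong:
  assumes "\<And>H. H \<in> carrier_mat m n \<Longrightarrow> f H = g H"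
  shows "ensemble_expectation n m f = ensemble_expectation n m g"
  using assms by (simp add: ensemble_expectation_def code_ensemble_def)

lemma ensemble_expectation_sum:
  "ensemble_expectation n m (\<lambda>H. \<Sum>x\<in>A. f x H) = (\<Sum>x\<in>A. ensemble_expectation n m (f x))"
  unfolding ensemble_expectation_def sum_distrib_left by (rule sum.swap)

lemma ensemble_cov_sum:
  "ensemble_cov n m (\<lambda>H. \<Sum>x\<in>A. f x H) (\<lambda>H. \<Sum>y\<in>B. g y H)
    = (\<Sum>x\<in>A. \<Sum>y\<in>B. ensemble_cov n m (f x) (g y))"
  by (simp add: ensemble_cov_def sum_product ensemble_expectation_sum sum_subtractf)

lemma weight_distribution_eq_sum:
  assumes "H \<in> carrier_mat m n"
  shows "real (weight_distribution w H)
    = (\<Sum>x | x \<in> carrier_vec n \<and> hamming_weight x = w. of_bool (H *\<^sub>v x = 0\<^sub>v m))"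
  using assms finite_carrier_bit_vec[of n]
  by (auto simp: weight_distribution_def Int_def conj_assoc intro!: arg_cong[where f = card])

theorem theorem1:
  fixes m n w1 w2 :: nat
  assumes "0 < m" and "0 < n"
    and "0 < w1" and "w1 \<le> n"
    and "0 < w2" and "w2 \<le> n"
  shows "ensemble_cov n m (\<lambda>H. real (weight_distribution w1 H))
                          (\<lambda>H. real (weight_distribution w2 H)) =
           (if w1 = w2 then (1 - 1 / 2 ^ m) * (1 / 2 ^ m) * real (n choose w1) else 0)"
proof -
  define W where "W w = {x. x \<in> carrier_vec n \<and> hamming_weight x = w}" for w
  define c :: real where "c = (1 - 1 / 2 ^ m) * (1 / 2 ^ m)"
  let ?ind = "\<lambda>x H. of_bool (H *\<^sub>v x = 0\<^sub>v m) :: real"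
  have fin: "finite (W w)" for w
    using finite_carrier_bit_vec by (simp add: W_def)
  have nonzero: "x \<noteq> 0\<^sub>v n" if "x \<in> W w" "0 < w" for x w
    using that by (auto simp: W_def hamming_weight_zero_vec)
  have "ensemble_cov n m (\<lambda>H. real (weight_distribution w1 H)) (\<lambda>H. real (weight_distribution w2 H))
      = ensemble_cov n m (\<lambda>H. \<Sum>x\<in>W w1. ?ind x H) (\<lambda>H. \<Sum>y\<in>W w2. ?ind y H)"
    \<comment> \<open>\<open>weight_distribution\<close> reads its dimensions off \<open>H\<close>,
      so the indicator sum can replace it only on \<open>m\<close> by \<open>n\<close> matrices,
      inside each expectation.\<close>
    unfolding ensemble_cov_def W_def
    by (intro arg_cong2[where f = minus] arg_cong2[where f = times] ensemble_expectation_cong)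
      (simp_all only: weight_distribution_eq_sum)
  also have "\<dots> = (\<Sum>x\<in>W w1. \<Sum>y\<in>W w2. if x = y then c else 0)"
    unfolding ensemble_cov_sum c_def
    \<comment> \<open>Positive weights exclude the zero word, whose indicator is constantly
      1.\<close>
    by (intro sum.cong refl ensemble_cov_kernel_indicators)
      (use nonzero assms in \<open>auto simp: W_def\<close>)
  \<comment> \<open>The inner sum can only pick \<open>y = x\<close>, and a word of weight
    \<open>w1\<close> lies in \<open>W w2\<close> exactly when \<open>w1 = w2\<close>.\<close>
  also have "\<dots> = (\<Sum>x\<in>W w1. if w1 = w2 then c else 0)"
    by (intro sum.cong refl) (auto simp: fin, auto simp: W_def)
  also have "\<dots> = (if w1 = w2 then c * real (n choose w1) else 0)"
    by (simp add: W_def card_hamming_weight_eq)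
  finally show ?thesis
    by (simp add: c_def)
qed

end
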